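(* Let $X$ be a nonempty set equipped with a separated uniformity $\mathscr U$ generated by a nonempty family $\mathscr F$ of pseudometrics with associated collection $\mathscr V$ of basic entourages, and let $G$ be a directed graph with $V(G)=X$ and $E(G)\supseteq\Delta(X)$. Let $X$ be complete and let $T:X\to X$ be an orbitally continuous Banach $G$-contraction, with set of fixed points $\mathrm{Fix}(T)$. Then: 1. If $x\in X$ is such that $Tx\in[x]_{\widetilde G}$, then there exists a unique $x^*\in\mathrm{Fix}(T)$ such that $T^ny\to x^*$ for all $y\in[x]_{\widetilde G}$. In particular, if $x^*\in[x]_{\widetilde G}$, then $T|_{[x]_{\widetilde G}}$ is a Picard operator. 2. If $G$ is weakly connected, then $T$ is a Picard operator. 3. $T$ has a fixed point in $X$ if and only if there exists an $x\in X$ such that $Tx\in[x]_{\widetilde G}$. 4. $T|_{X''}$ is a weakly Picard operator, where $X''=\bigcup\{[x]_{\widetilde G}:x\in X,\ Tx\in[x]_{\widetilde G}\}$. 5. If $Tx\in[x]_{\widetilde G}$ for all $x\in X$, then $T$ is a weakly Picard operator.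
   Context: Uniform structure: $\mathscr U$ is a uniformity on $X$; separated means $\bigcap\mathscr U=\Delta(X)=\{(x,x):x\in X\}$. Convergence is in the uniform topology; $X$ is complete if every Cauchy net converges. $\mathscr F$ is a nonempty family of (uniformly continuous) pseudometrics on $X$ generating $\mathscr U$. For a pseudometric $\rho$ and $r>0$ put $V(\rho,r)=\{(x,y)\in X\times X:\rho(x,y)<r\}$. $\mathscr V$ is the collection of all sets $\bigcap_{i=1}^m V(\rho_i,r_i)$ with $m\ge1$, $\rho_i\in\mathscr F$, $r_i>0$; it is a base of $\mathscr U$ and its members are called basic entourages. For $V=\bigcap_{i=1}^mV(\rho_i,r_i)\in\mathscr V$ and $\alpha>0$, put $\alpha V=\bigcap_{i=1}^mV(\rho_i,\alpha r_i)$ (a basic entourage is regarded as given together with such a presentation, and $\alpha V$ is formed from it). Graphs: $G$ has vertex set $X$ and edge set $E(G)\subseteq X\times X$ (directed, no parallel edges) containing all loops. $\widetilde G$ has vertex set $X$ and $E(\widetilde G)=\{(x,y):(x,y)\in E(G)\text{ or }(y,x)\in E(G)\}$. $[x]_{\widetilde G}$ is the set of all $y\in X$ joined to $x$ by a path in $\widetilde G$, i.e. a finite sequence $x_0=x,\dots,x_N=y$ with $(x_{i-1},x_i)\in E(\widetilde G)$ for $i=1,\dots,N$. $G$ is weakly connected if $[x]_{\widetilde G}=X$ for all $x\in X$. A mapping $T:X\to X$ is a Banach $G$-contraction if (B1) $(x,y)\in E(G)$ implies $(Tx,Ty)\in E(G)$ for all $x,y\in X$; and (B2) there is $\alpha\in(0,1)$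 such that $(x,y)\in V\cap E(G)$ implies $(Tx,Ty)\in\alpha V$ for all $x,y\in X$ and all $V\in\mathscr V$. $T$ is orbitally continuous on $X$ if for all $x,y\in X$ and every sequence $\{p_n\}$ of positive integers, $T^{p_n}x\to y$ implies $T(T^{p_n}x)\to Ty$ as $n\to\infty$. $T$ is a Picard operator if it has a unique fixed point $x^*$ and $T^nx\to x^*$ for all $x$ in its domain; it is a weakly Picard operator if for every $x$ in its domain $\{T^nx\}$ converges to a fixed point of $T$. For $A\subseteq X$, saying that $T|_A$ is a Picard operator means that $T(A)\subseteq A$ and that $T|_A:A\to A$ is a Picard operator (with fixed point in $A$). Saying that $T|_{X''}$ is a weakly Picard operator means that $T(X'')\subseteq X''$ and that for every $x\in X''$ the sequence $\{T^nx\}$ converges to a fixed point of $T$ (vacuous if $X''=\emptyset$). *)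

theory Defs
  imports "HOL-Analysis.Analysis"
begin

section \<open>Uniformities generated by pseudometrics\<close>

definition pseudometric :: "('a \<Rightarrow> 'a \<Rightarrow> real) \<Rightarrow> bool" where
  "pseudometric \<rho> \<longleftrightarrow>
     (\<forall>x y. 0 \<le> \<rho> x y) \<and> (\<forall>x. \<rho> x x = 0) \<and> (\<forall>x y. \<rho> x y = \<rho> y x) \<and>
     (\<forall>x y z. \<rho> x z \<le> \<rho> x y + \<rho> y z)"

definition pball :: "('a \<Rightarrow> 'a \<Rightarrow> real) \<Rightarrow> real \<Rightarrow> ('a \<times> 'a) set" where
  "pball \<rho> r = {(x, y). \<rho> x y < r}"

text \<open>
  The multiple \<open>\<alpha>V\<close> of a basic entourage depends on how \<open>V\<close> is written as an intersection, so a
  basic entourage is represented by its presentation: a nonempty list of pairs \<open>(\<rho>\<^sub>i, r\<^sub>i)\<close>.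
\<close>

definition presentations :: "('a \<Rightarrow> 'a \<Rightarrow> real) set \<Rightarrow> (('a \<Rightarrow> 'a \<Rightarrow> real) \<times> real) list set" where
  "presentations F = {ps. ps \<noteq> [] \<and> set ps \<subseteq> F \<times> {0<..}}"

definition entourage :: "(('a \<Rightarrow> 'a \<Rightarrow> real) \<times> real) list \<Rightarrow> ('a \<times> 'a) set" where
  "entourage ps = (\<Inter>(\<rho>, r) \<in> set ps. pball \<rho> r)"

definition scale :: "real \<Rightarrow> (('a \<Rightarrow> 'a \<Rightarrow> real) \<times> real) list \<Rightarrow> (('a \<Rightarrow> 'a \<Rightarrow> real) \<times> real) list" where
  "scale \<alpha> ps = map (\<lambda>(\<rho>, r). (\<rho>, \<alpha> * r)) ps"

text \<open>
  The ambient uniformity is the filter generated by the sets \<open>pball \<rho> r\<close>; in particular every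
  member of the family is uniformly continuous, and the basic entourages form a base
  (lemma \<open>generates_uniformity_base\<close>).
\<close>

definition generates_uniformity :: "('a::uniform_space \<Rightarrow> 'a \<Rightarrow> real) set \<Rightarrow> bool" where
  "generates_uniformity F \<longleftrightarrow>
     F \<noteq> {} \<and> (\<forall>\<rho>\<in>F. pseudometric \<rho>) \<and>
     uniformity = (INF (\<rho>, r) \<in> F \<times> {0<..}. principal (pball \<rho> r))"

lemma generates_uniformity_base:
  assumes "generates_uniformity F"
  shows "eventually P uniformity \<longleftrightarrow> (\<exists>ps\<in>presentations F. \<forall>p\<in>entourage ps. P p)"
proof -
  let ?B = "\<lambda>q :: ('a \<Rightarrow> 'a \<Rightarrow> real) \<times> real. pball (fst q) (snd q)"
  obtain \<rho>\<^sub>0 where \<rho>\<^sub>0: "\<rho>\<^sub>0 \<in> F"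
    using assms by (auto simp: generates_uniformity_def)
  have ent: "entourage ps = (\<Inter>q\<in>set ps. ?B q)" for ps
    by (auto simp: entourage_def)
  have U: "uniformity = (INF q \<in> F \<times> {0<..}. principal (?B q))"
    using assms by (simp add: generates_uniformity_def case_prod_unfold)
  have 1: "eventually P uniformity \<longleftrightarrow>
      (\<exists>Q \<subseteq> F \<times> {0<..}. finite Q \<and> eventually P (INF q\<in>Q. principal (?B q)))"
    unfolding U by (rule eventually_INF)
  have 2: "eventually P (INF q\<in>Q. principal (?B q)) \<longleftrightarrow> (\<forall>p \<in> (\<Inter>q\<in>Q. ?B q). P p)"
    if "finite Q" for Q
    using that by (simp only: INF_principal_finite eventually_principal)
  have ev: "eventually P uniformity \<longleftrightarrow>
      (\<exists>Q \<subseteq> F \<times> {0<..}. finite Q \<and> (\<forall>p \<in> (\<Inter>q\<in>Q. ?B q). P p))"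
  proof -
    have "(\<exists>Q. Q \<subseteq> F \<times> {0<..} \<and> finite Q \<and> eventually P (INF q\<in>Q. principal (?B q))) \<longleftrightarrow>
        (\<exists>Q. Q \<subseteq> F \<times> {0<..} \<and> finite Q \<and> (\<forall>p \<in> (\<Inter>q\<in>Q. ?B q). P p))"
      by (rule ex_cong1, rule conj_cong[OF refl], rule conj_cong[OF refl], rule 2)
    with 1 show ?thesis by (rule trans)
  qed
  show ?thesis
  proof
    assume "eventually P uniformity"
    then obtain Q where Q: "Q \<subseteq> F \<times> {0<..}" "finite Q" "\<forall>p \<in> (\<Inter>q\<in>Q. ?B q). P p"
      unfolding ev by (elim exE conjE)
    obtain qs where "set qs = Q" using Q(2) finite_list by blast
    then have "(\<rho>\<^sub>0, 1) # qs \<in> presentations F" "\<forall>p\<in>entourage ((\<rho>\<^sub>0, 1) # qs). P p"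
      using Q(1,3) \<rho>\<^sub>0 unfolding presentations_def ent by simp_all
    then show "\<exists>ps\<in>presentations F. \<forall>p\<in>entourage ps. P p" by blast
  next
    assume "\<exists>ps\<in>presentations F. \<forall>p\<in>entourage ps. P p"
    then obtain ps where "ps \<in> presentations F" "\<forall>p\<in>entourage ps. P p" by blast
    then have "set ps \<subseteq> F \<times> {0<..} \<and> finite (set ps) \<and> (\<forall>p \<in> (\<Inter>q\<in>set ps. ?B q). P p)"
      unfolding presentations_def ent by simp
    then show "eventually P uniformity" unfolding ev by (rule exI)
  qed
qed

definition separated :: "'a::uniform_space itself \<Rightarrow> bool" where
  "separated _ \<longleftrightarrow> \<Inter>{U :: ('a \<times> 'a) set. eventually (\<lambda>p. p \<in> U) uniformity} = Id"

section \<open>Graphs\<close>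

text \<open>A graph on the whole type is given by its edge set.\<close>

definition undirected :: "('a \<times> 'a) set \<Rightarrow> ('a \<times> 'a) set" where
  "undirected E = {(x, y). (x, y) \<in> E \<or> (y, x) \<in> E}"

definition component :: "('a \<times> 'a) set \<Rightarrow> 'a \<Rightarrow> 'a set" where
  "component E x = {y. \<exists>N p. p 0 = x \<and> p N = y \<and> (\<forall>i<N. (p i, p (Suc i)) \<in> undirected E)}"

definition weakly_connected :: "('a \<times> 'a) set \<Rightarrow> bool" where
  "weakly_connected E \<longleftrightarrow> (\<forall>x. component E x = UNIV)"

section \<open>Classes of mappings\<close>

definition banach_contraction ::
    "('a \<Rightarrow> 'a \<Rightarrow> real) set \<Rightarrow> ('a \<times> 'a) set \<Rightarrow> ('a \<Rightarrow> 'a) \<Rightarrow> bool" where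
  "banach_contraction F E T \<longleftrightarrow>
     (\<forall>x y. (x, y) \<in> E \<longrightarrow> (T x, T y) \<in> E) \<and>
     (\<exists>\<alpha>. 0 < \<alpha> \<and> \<alpha> < 1 \<and>
       (\<forall>ps\<in>presentations F. \<forall>x y. (x, y) \<in> entourage ps \<inter> E \<longrightarrow>
          (T x, T y) \<in> entourage (scale \<alpha> ps)))"

definition orbitally_continuous :: "('a::topological_space \<Rightarrow> 'a) \<Rightarrow> bool" where
  "orbitally_continuous T \<longleftrightarrow>
     (\<forall>x y. \<forall>p :: nat \<Rightarrow> nat. (\<forall>n. 0 < p n) \<longrightarrow>
        (\<lambda>n. (T ^^ p n) x) \<longlonglongrightarrow> y \<longrightarrow> (\<lambda>n. T ((T ^^ p n) x)) \<longlonglongrightarrow> T y)"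

definition Fix :: "('a \<Rightarrow> 'a) \<Rightarrow> 'a set" where
  "Fix T = {x. T x = x}"

definition picard_on :: "'a::topological_space set \<Rightarrow> ('a \<Rightarrow> 'a) \<Rightarrow> bool" where
  "picard_on A T \<longleftrightarrow> T ` A \<subseteq> A \<and>
     (\<exists>z. z \<in> A \<inter> Fix T \<and> (\<forall>w \<in> A \<inter> Fix T. w = z) \<and> (\<forall>x\<in>A. (\<lambda>n. (T ^^ n) x) \<longlonglongrightarrow> z))"

definition weakly_picard_on :: "'a::topological_space set \<Rightarrow> ('a \<Rightarrow> 'a) \<Rightarrow> bool" where
  "weakly_picard_on A T \<longleftrightarrow> T ` A \<subseteq> A \<and>
     (\<forall>x\<in>A. \<exists>z \<in> Fix T. (\<lambda>n. (T ^^ n) x) \<longlonglongrightarrow> z)"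

end

theory Submission
  imports Defs
begin

text \<open>
  The contraction condition on entourages amounts to \<open>\<rho> (T x) (T y) \<le> \<alpha> * \<rho> x y\<close> for every edge
  \<open>(x, y)\<close> and every generating pseudometric \<open>\<rho>\<close>. Summing along a path, the \<open>\<rho>\<close>-distance of the
  orbits of two vertices of one component is \<open>O(\<alpha>\<^sup>n)\<close>. Applied to \<open>x\<close> and \<open>T x\<close> this makes the orbit
  of \<open>x\<close> Cauchy, and orbital continuity makes its limit a fixed point; applied to \<open>x\<close> and \<open>y\<close> it
  shows that all orbits starting in the component share this limit.
\<close>

section \<open>Uniform convergence and Cauchy sequences in terms of the pseudometrics\<close>

lemma pseudometricD:
  assumes "pseudometric \<rho>"
  shows "0 \<le> \<rho> x y" "\<rho> x x = 0" "\<rho> x y = \<rho> y x" "\<rho> x z \<le> \<rho> x y + \<rho> y z"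
  using assms unfolding pseudometric_def by blast+

lemma generates_uniformityD:
  assumes "generates_uniformity F"
  shows "\<rho> \<in> F \<Longrightarrow> pseudometric \<rho>"
  using assms by (simp add: generates_uniformity_def)

text \<open>A limit into an infimum of principal filters can be tested on each generator
  \<open>pball \<rho> r\<close>; for fixed \<open>\<rho>\<close>, letting \<open>r\<close> range
  over the positive reals gives a real limit. Uniform statements thereby reduce to real
  analysis.\<close>

lemma filterlim_uniformity_iff_pseudometrics:
  assumes F: "generates_uniformity F"
  shows "filterlim (\<lambda>i. (f i, g i)) uniformity G \<longleftrightarrow>
    (\<forall>\<rho>\<in>F. ((\<lambda>i. \<rho> (f i) (g i)) \<longlongrightarrow> 0) G)"
proof -
  have U: "uniformity = (INF (\<rho>, r) \<in> F \<times> {0<..}. principal (pball \<rho> r))"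
    using F by (simp add: generates_uniformity_def)
  have "((\<lambda>i. \<rho> (f i) (g i)) \<longlongrightarrow> 0) G \<longleftrightarrow> (\<forall>r>0. eventually (\<lambda>i. \<rho> (f i) (g i) < r) G)"
    if "\<rho> \<in> F" for \<rho>
    using pseudometricD(1)[OF generates_uniformityD[OF F that]] by (simp add: tendsto_iff)
  then show ?thesis
    unfolding U filterlim_INF by (auto simp: filterlim_principal pball_def)
qed

text \<open>By \<open>eventually_nhds_uniformity\<close>, neighbourhoods of \<open>z\<close> are the
  sections of entourages at first coordinate \<open>z\<close>.\<close>

lemma tendsto_iff_filterlim_uniformity:
  fixes f :: "'i \<Rightarrow> 'a::uniform_space"
  shows "(f \<longlongrightarrow> z) G \<longleftrightarrow> filterlim (\<lambda>i. (z, f i)) uniformity G"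
proof
  assume lim: "(f \<longlongrightarrow> z) G"
  show "filterlim (\<lambda>i. (z, f i)) uniformity G"
    unfolding filterlim_iff
  proof (intro allI impI)
    fix P :: "'a \<times> 'a \<Rightarrow> bool"
    assume "eventually P uniformity"
    then have "eventually (\<lambda>y. P (z, y)) (nhds z)"
      unfolding eventually_nhds_uniformity by (rule eventually_mono) auto
    with lim show "eventually (\<lambda>i. P (z, f i)) G"
      unfolding filterlim_iff by blast
  qed
next
  assume lim: "filterlim (\<lambda>i. (z, f i)) uniformity G"
  show "(f \<longlongrightarrow> z) G"
    unfolding filterlim_iff
  proof (intro allI impI)
    fix P
    assume "eventually P (nhds z)"
    then have "eventually (\<lambda>(x, y). x = z \<longrightarrow> P y) uniformity"
      by (simp add: eventually_nhds_uniformity)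
    with lim have "eventually (\<lambda>i. case (z, f i) of (x, y) \<Rightarrow> x = z \<longrightarrow> P y) G"
      unfolding filterlim_iff by blast
    then show "eventually (\<lambda>i. P (f i)) G" by simp
  qed
qed

lemma tendsto_iff_pseudometrics:
  assumes "generates_uniformity F"
  shows "(f \<longlongrightarrow> z) G \<longleftrightarrow> (\<forall>\<rho>\<in>F. ((\<lambda>i. \<rho> z (f i)) \<longlongrightarrow> 0) G)"
  using tendsto_iff_filterlim_uniformity filterlim_uniformity_iff_pseudometrics[OF assms]
  by (rule trans)

text \<open>A bound that depends only on the smaller index controls all pairs of large indices, so
  the pairs of terms tend to the uniformity along the product filter, which is the Cauchy
  property.\<close>

lemma Cauchy_if_pseudometrics:
  fixes F :: "('a::uniform_space \<Rightarrow> 'a \<Rightarrow> real) set" and X :: "nat \<Rightarrow> 'a"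
  assumes F: "generates_uniformity F"
    and small: "\<And>\<rho>. \<rho> \<in> F \<Longrightarrow> \<exists>b. b \<longlonglongrightarrow> 0 \<and> (\<forall>m n. m \<le> n \<longrightarrow> \<rho> (X m) (X n) \<le> b m)"
  shows "Cauchy X"
proof -
  have "((\<lambda>(m, n). \<rho> (X m) (X n)) \<longlongrightarrow> 0) (sequentially \<times>\<^sub>F sequentially)" if "\<rho> \<in> F" for \<rho>
  proof -
    note \<rho> = pseudometricD[OF generates_uniformityD[OF F that]]
    obtain b where b: "b \<longlonglongrightarrow> 0" "\<And>m n. m \<le> n \<Longrightarrow> \<rho> (X m) (X n) \<le> b m"
      using small[OF \<open>\<rho> \<in> F\<close>] by blast
    have b0: "0 \<le> b m" for m
      using b(2)[of m m] \<rho>(2) by simp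
    have le: "\<rho> (X m) (X n) \<le> b m + b n" for m n
      using b(2)[of m n] b(2)[of n m] \<rho>(3)[of "X m" "X n"] b0[of m] b0[of n]
      by (cases "m \<le> n") auto
    have "((\<lambda>p. b (fst p) + b (snd p)) \<longlongrightarrow> 0 + 0) (sequentially \<times>\<^sub>F sequentially)"
      by (intro tendsto_add filterlim_compose[OF b(1)] filterlim_fst filterlim_snd)
    then have "((\<lambda>p. b (fst p) + b (snd p)) \<longlongrightarrow> 0) (sequentially \<times>\<^sub>F sequentially)" by simp
    then show ?thesis
      by (rule tendsto_sandwich[OF _ _ tendsto_const, rotated 2])
         (auto simp: \<rho>(1) le case_prod_unfold)
  qed
  then have "filterlim (\<lambda>p. (X (fst p), X (snd p))) uniformity (sequentially \<times>\<^sub>F sequentially)"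
    unfolding filterlim_uniformity_iff_pseudometrics[OF F] by (simp add: case_prod_unfold)
  then show ?thesis
    by (simp add: Cauchy_uniform cauchy_filter_def prod_filtermap1 prod_filtermap2
        filtermap_filtermap filterlim_def case_prod_unfold comp_def)
qed

text \<open>\<open>complete\<close> speaks about Cauchy filters; it is applied to the image of
  \<open>sequentially\<close> under the sequence, which is proper.\<close>

lemma complete_UNIV_Cauchy_converges:
  fixes X :: "nat \<Rightarrow> 'a::uniform_space"
  assumes "complete (UNIV :: 'a set)" "Cauchy X"
  obtains z where "X \<longlonglongrightarrow> z"
  using cauchy_filter_complete_converges[of "filtermap X sequentially" UNIV] assms
  by (auto simp: Cauchy_uniform filterlim_def filtermap_bot_iff)

text \<open>The triangle inequality through \<open>f i\<close> forces every generating pseudometric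
  to vanish at \<open>(z, w)\<close>. The pair then lies in every entourage, hence on the
  diagonal.\<close>

lemma separated_tendsto_unique:
  fixes F :: "('a::uniform_space \<Rightarrow> 'a \<Rightarrow> real) set" and f :: "'i \<Rightarrow> 'a"
  assumes sep: "separated TYPE('a)" and F: "generates_uniformity F"
    and G: "G \<noteq> bot" and z: "(f \<longlongrightarrow> z) G" and w: "(f \<longlongrightarrow> w) G"
  shows "z = w"
proof -
  have zero: "\<rho> z w = 0" if "\<rho> \<in> F" for \<rho>
  proof -
    note \<rho> = pseudometricD[OF generates_uniformityD[OF F that]]
    have "((\<lambda>i. \<rho> z (f i) + \<rho> w (f i)) \<longlongrightarrow> 0 + 0) G"
      using z w that unfolding tendsto_iff_pseudometrics[OF F] by (intro tendsto_add) auto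
    moreover have "\<rho> z w \<le> \<rho> z (f i) + \<rho> w (f i)" for i
      using \<rho>(4)[of z w "f i"] \<rho>(3)[of w "f i"] by simp
    ultimately have "\<rho> z w \<le> 0"
      using tendsto_lowerbound[of _ 0 G "\<rho> z w"] G by simp
    with \<rho>(1)[of z w] show ?thesis by simp
  qed
  \<comment> \<open>The constant map turns vanishing pseudometrics into membership in all
    entourages: along a proper filter, a constant statement that holds eventually is true.\<close>
  have "filterlim (\<lambda>_. (z, w)) uniformity G"
    unfolding filterlim_uniformity_iff_pseudometrics[OF F] by (simp add: zero)
  then have "(z, w) \<in> \<Inter>{U. eventually (\<lambda>p. p \<in> U) uniformity}"
    using G by (auto simp: filterlim_iff)
  with sep show ?thesis by (auto simp: separated_def)
qed

section \<open>Components as reachability classes and their images under edge-preserving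
  maps\<close>

lemma component_eq_rtrancl_Image: "component E x = (undirected E)\<^sup>* `` {x}"
  by (simp only: component_def Image_singleton rtrancl_power relpow_fun_conv)

lemma component_refl: "x \<in> component E x"
  by (simp add: component_eq_rtrancl_Image)

lemma component_trans: "y \<in> component E x \<Longrightarrow> z \<in> component E y \<Longrightarrow> z \<in> component E x"
  by (auto simp: component_eq_rtrancl_Image)

lemma component_map:
  assumes "\<And>x y. (x, y) \<in> E \<Longrightarrow> (T x, T y) \<in> E" and "y \<in> component E x"
  shows "T y \<in> component E (T x)"
proof -
  have "(T x, T y) \<in> (undirected E)\<^sup>*" if "(x, y) \<in> (undirected E)\<^sup>*" for x y
    using that
  proof induction
    case (step y z)
    then have "(T y, T z) \<in> undirected E"
      using assms(1) by (auto simp: undirected_def)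
    with step.IH show ?case by simp
  qed simp
  with assms(2) show ?thesis by (simp add: component_eq_rtrancl_Image)
qed

text \<open>The component of \<open>x\<close> is mapped into that of \<open>T x\<close>, whose
  vertices are reachable from \<open>x\<close> through \<open>T x\<close>.\<close>

lemma component_image_subset:
  assumes "\<And>x y. (x, y) \<in> E \<Longrightarrow> (T x, T y) \<in> E" and "T x \<in> component E x"
  shows "T ` component E x \<subseteq> component E x"
  using component_map[where T = T and E = E and x = x] assms component_trans[OF assms(2)] by blast

section \<open>Contraction estimates along edges, paths and orbits\<close>

lemma banach_contraction_edge:
  assumes "banach_contraction F E T" "generates_uniformity F"
  obtains \<alpha> where "0 < \<alpha>" "\<alpha> < 1"
    "\<And>\<rho> x y. \<rho> \<in> F \<Longrightarrow> (x, y) \<in> undirected E \<Longrightarrow> \<rho> (T x) (T y) \<le> \<alpha> * \<rho> x y"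
proof -
  obtain \<alpha> where \<alpha>: "0 < \<alpha>" "\<alpha> < 1"
    and contr: "\<And>ps x y. ps \<in> presentations F \<Longrightarrow> (x, y) \<in> entourage ps \<inter> E \<Longrightarrow>
      (T x, T y) \<in> entourage (scale \<alpha> ps)"
    using assms(1) unfolding banach_contraction_def by blast
  have edge: "\<rho> (T x) (T y) \<le> \<alpha> * \<rho> x y" if "\<rho> \<in> F" "(x, y) \<in> E" for \<rho> x y
  proof -
    have nonneg: "0 \<le> \<rho> x y"
      using pseudometricD(1)[OF generates_uniformityD[OF assms(2) that(1)]] .
    \<comment> \<open>The one-element presentation \<open>[(\<rho>, r)]\<close> isolates a single
      pseudometric; \<open>r\<close> is positive because \<open>\<rho> x y\<close> is
      nonnegative.\<close>
    have less: "\<rho> (T x) (T y) < \<alpha> * r" if "\<rho> x y < r" for r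
      using contr[of "[(\<rho>, r)]" x y] that nonneg \<open>\<rho> \<in> F\<close> \<open>(x, y) \<in> E\<close>
      by (simp add: presentations_def entourage_def scale_def pball_def)
    \<comment> \<open>Dividing by \<open>\<alpha>\<close> prepares the limit of \<open>r\<close>
      down to \<open>\<rho> x y\<close>, which also covers \<open>\<rho> x y = 0\<close>.\<close>
    have "\<rho> (T x) (T y) / \<alpha> \<le> r" if "\<rho> x y < r" for r
      using less[OF that] \<alpha> by (simp add: field_simps)
    then have "\<rho> (T x) (T y) / \<alpha> \<le> \<rho> x y"
      by (rule dense_ge)
    then show ?thesis using \<alpha> by (simp add: field_simps)
  qed
  have "\<rho> (T x) (T y) \<le> \<alpha> * \<rho> x y" if "\<rho> \<in> F" "(x, y) \<in> undirected E" for \<rho> x y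
    using that edge[of \<rho> x y] edge[of \<rho> y x]
      pseudometricD(3)[OF generates_uniformityD[OF assms(2) that(1)]]
    by (auto simp: undirected_def)
  with \<alpha> show thesis by (rule that)
qed

text \<open>Each edge of a path from \<open>x\<close> to \<open>y\<close> shrinks by the factor
  \<open>\<alpha>\<close> per iteration, so \<open>C\<close> can be the total
  \<open>\<rho>\<close>-length of the path.\<close>

lemma pseudometric_component_decay:
  assumes "pseudometric \<rho>" and "0 \<le> \<alpha>"
    and pres: "\<And>x y. (x, y) \<in> E \<Longrightarrow> (T x, T y) \<in> E"
    and edge: "\<And>x y. (x, y) \<in> undirected E \<Longrightarrow> \<rho> (T x) (T y) \<le> \<alpha> * \<rho> x y"
    and "y \<in> component E x"
  obtains C where "0 \<le> C" "\<And>n. \<rho> ((T ^^ n) x) ((T ^^ n) y) \<le> C * \<alpha> ^ n"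
proof -
  note \<rho> = pseudometricD[OF assms(1)]
  \<comment> \<open>The induction must carry edge membership along with the bound, since the
    contraction estimate is available only on edges.\<close>
  have edge_pow: "((T ^^ n) x, (T ^^ n) y) \<in> undirected E \<and>
      \<rho> ((T ^^ n) x) ((T ^^ n) y) \<le> \<rho> x y * \<alpha> ^ n" if "(x, y) \<in> undirected E" for n x y
  proof (induction n)
    case (Suc n)
    then have "\<rho> ((T ^^ Suc n) x) ((T ^^ Suc n) y) \<le> \<alpha> * \<rho> ((T ^^ n) x) ((T ^^ n) y)"
      using edge by simp
    also have "\<dots> \<le> \<alpha> * (\<rho> x y * \<alpha> ^ n)"
      using Suc \<open>0 \<le> \<alpha>\<close> by (intro mult_left_mono) auto
    finally show ?case
      using Suc pres by (auto simp: undirected_def mult_ac)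
  qed (use that in simp)
  have "(x, y) \<in> (undirected E)\<^sup>*"
    using assms(5) by (simp add: component_eq_rtrancl_Image)
  then have "\<exists>C\<ge>0. \<forall>n. \<rho> ((T ^^ n) x) ((T ^^ n) y) \<le> C * \<alpha> ^ n"
  proof induction
    case base
    show ?case using \<rho>(2) by (intro exI[of _ 0]) simp
  next
    case (step y z)
    then obtain C where C: "0 \<le> C" "\<And>n. \<rho> ((T ^^ n) x) ((T ^^ n) y) \<le> C * \<alpha> ^ n" by blast
    have "\<rho> ((T ^^ n) x) ((T ^^ n) z) \<le> (C + \<rho> y z) * \<alpha> ^ n" for n
      using \<rho>(4)[of "(T ^^ n) x" "(T ^^ n) z" "(T ^^ n) y"] C(2)[of n] edge_pow[OF step.hyps(2), of n]
      by (simp add: distrib_right)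
    with C(1) \<rho>(1)[of y z] show ?case by (intro exI[of _ "C + \<rho> y z"]) simp
  qed
  then show thesis using that by blast
qed

lemma pseudometric_geometric_tail:
  fixes \<alpha> :: real
  assumes "pseudometric \<rho>" "0 \<le> \<alpha>" "\<alpha> < 1" "0 \<le> C"
    and step: "\<And>n. \<rho> (X n) (X (Suc n)) \<le> C * \<alpha> ^ n" and "m \<le> n"
  shows "\<rho> (X m) (X n) \<le> C / (1 - \<alpha>) * \<alpha> ^ m"
proof -
  note \<rho> = pseudometricD[OF assms(1)]
  \<comment> \<open>The right-hand side is the exact geometric sum of
    \<open>C * \<alpha> ^ k\<close> for \<open>k\<close> from \<open>m\<close> to
    \<open>n - 1\<close>; keeping the term \<open>\<alpha> ^ n\<close> lets the induction
    telescope.\<close>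
  have "\<rho> (X m) (X n) \<le> C / (1 - \<alpha>) * (\<alpha> ^ m - \<alpha> ^ n)"
    using \<open>m \<le> n\<close>
  proof (induction n rule: dec_induct)
    case base
    show ?case using \<rho>(2) by simp
  next
    case (step n)
    have "C * \<alpha> ^ n = C / (1 - \<alpha>) * (\<alpha> ^ n - \<alpha> ^ Suc n)"
      using \<open>\<alpha> < 1\<close> by (simp add: field_simps)
    then show ?case
      using step.IH assms(5)[of n] \<rho>(4)[of "X m" "X (Suc n)" "X n"] by (simp add: right_diff_distrib)
  qed
  also have "\<dots> \<le> C / (1 - \<alpha>) * \<alpha> ^ m"
    using assms(2-4) by (intro mult_left_mono) auto
  finally show ?thesis .
qed

section \<open>The common limit of the orbits starting in a component\<close>

lemma component_orbits_converge_to_fixed_point: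
  fixes F :: "('a::uniform_space \<Rightarrow> 'a \<Rightarrow> real) set"
  assumes sep: "separated TYPE('a)"
    and F: "generates_uniformity F"
    and compl: "complete (UNIV :: 'a set)"
    and contr: "banach_contraction F E T"
    and orb: "orbitally_continuous T"
    and x: "T x \<in> component E x"
  obtains z where "z \<in> Fix T" "\<And>y. y \<in> component E x \<Longrightarrow> (\<lambda>n. (T ^^ n) y) \<longlonglongrightarrow> z"
proof -
  have pres: "\<And>x y. (x, y) \<in> E \<Longrightarrow> (T x, T y) \<in> E"
    using contr by (simp add: banach_contraction_def)
  obtain \<alpha> where \<alpha>: "0 < \<alpha>" "\<alpha> < 1"
    and edge: "\<And>\<rho> x y. \<rho> \<in> F \<Longrightarrow> (x, y) \<in> undirected E \<Longrightarrow> \<rho> (T x) (T y) \<le> \<alpha> * \<rho> x y"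
    using banach_contraction_edge[OF contr F] by blast
  have \<alpha>0: "0 \<le> \<alpha>" using \<alpha> by simp
  have lim0: "(\<lambda>n. C * \<alpha> ^ n) \<longlonglongrightarrow> 0" for C
    using tendsto_mult_right_zero[OF LIMSEQ_realpow_zero[OF \<alpha>0 \<alpha>(2)]] .
  have decay: "\<exists>C\<ge>0. \<forall>n. \<rho> ((T ^^ n) x) ((T ^^ n) y) \<le> C * \<alpha> ^ n"
    if "\<rho> \<in> F" "y \<in> component E x" for \<rho> y
  proof -
    have "\<rho> (T u) (T v) \<le> \<alpha> * \<rho> u v" if "(u, v) \<in> undirected E" for u v
      using edge[OF \<open>\<rho> \<in> F\<close> that] .
    then show ?thesis
      using pseudometric_component_decay[where \<rho> = \<rho> and T = T and E = E and \<alpha> = \<alpha> and x = x and y = y]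
        generates_uniformityD[OF F that(1)] \<alpha>0 pres that(2) by metis
  qed
  have "Cauchy (\<lambda>n. (T ^^ n) x)"
  proof (rule Cauchy_if_pseudometrics[OF F])
    fix \<rho> assume "\<rho> \<in> F"
    note \<rho> = generates_uniformityD[OF F this]
    \<comment> \<open>Since \<open>(T ^^ n) (T x)\<close> is the next orbit point, this bounds
      consecutive terms of the orbit of \<open>x\<close>.\<close>
    obtain C where C: "0 \<le> C" "\<And>n. \<rho> ((T ^^ n) x) ((T ^^ n) (T x)) \<le> C * \<alpha> ^ n"
      using decay[OF \<open>\<rho> \<in> F\<close> x] by blast
    then have "\<rho> ((T ^^ m) x) ((T ^^ n) x) \<le> C / (1 - \<alpha>) * \<alpha> ^ m" if "m \<le> n" for m n
      using pseudometric_geometric_tail[OF \<rho> \<alpha>0 \<alpha>(2) C(1), of "\<lambda>n. (T ^^ n) x"] that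
      by (simp add: funpow_swap1)
    then show "\<exists>b. b \<longlonglongrightarrow> 0 \<and> (\<forall>m n. m \<le> n \<longrightarrow> \<rho> ((T ^^ m) x) ((T ^^ n) x) \<le> b m)"
      using lim0 by blast
  qed
  then obtain z where z: "(\<lambda>n. (T ^^ n) x) \<longlonglongrightarrow> z"
    using complete_UNIV_Cauchy_converges[OF compl] by blast
  \<comment> \<open>Orbital continuity requires positive exponents, hence the shift to
    \<open>p n = Suc n\<close>.\<close>
  have "(\<lambda>n. (T ^^ Suc n) x) \<longlonglongrightarrow> z"
    using z by (rule LIMSEQ_Suc)
  then have "(\<lambda>n. T ((T ^^ Suc n) x)) \<longlonglongrightarrow> T z"
    using orb unfolding orbitally_continuous_def by blast
  moreover have "(\<lambda>n. T ((T ^^ Suc n) x)) \<longlonglongrightarrow> z"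
    using LIMSEQ_Suc[OF LIMSEQ_Suc[OF z]] by simp
  ultimately have "T z = z"
    by (rule separated_tendsto_unique[OF sep F sequentially_bot])
  moreover have "(\<lambda>n. (T ^^ n) y) \<longlonglongrightarrow> z" if y: "y \<in> component E x" for y
    unfolding tendsto_iff_pseudometrics[OF F]
  proof
    fix \<rho> assume "\<rho> \<in> F"
    note \<rho> = generates_uniformityD[OF F this]
    obtain C where C: "0 \<le> C" "\<And>n. \<rho> ((T ^^ n) x) ((T ^^ n) y) \<le> C * \<alpha> ^ n"
      using decay[OF \<open>\<rho> \<in> F\<close> y] by blast
    have "(\<lambda>n. \<rho> z ((T ^^ n) x)) \<longlonglongrightarrow> 0"
      using z \<open>\<rho> \<in> F\<close> by (simp add: tendsto_iff_pseudometrics[OF F])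
    from tendsto_add[OF this lim0[of C]]
    have "(\<lambda>n. \<rho> z ((T ^^ n) x) + C * \<alpha> ^ n) \<longlonglongrightarrow> 0" by simp
    \<comment> \<open>The orbit of \<open>y\<close> follows that of \<open>x\<close> up to a
      vanishing error, so it inherits the limit.\<close>
    moreover have "norm (\<rho> z ((T ^^ n) y)) \<le> \<rho> z ((T ^^ n) x) + C * \<alpha> ^ n" for n
      using pseudometricD(1)[OF \<rho>, of z "(T ^^ n) y"]
        pseudometricD(4)[OF \<rho>, of z "(T ^^ n) y" "(T ^^ n) x"] C(2)[of n] by simp
    ultimately show "(\<lambda>n. \<rho> z ((T ^^ n) y)) \<longlonglongrightarrow> 0"
      by (rule Lim_null_comparison[OF always_eventually[OF allI], rotated])
  qed
  ultimately show thesis using that by (simp add: Fix_def)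
qed

section \<open>Fixed points and Picard properties of the contraction\<close>

theorem theorem3:
  fixes F :: "('a::uniform_space \<Rightarrow> 'a \<Rightarrow> real) set"
    and E :: "('a \<times> 'a) set"
    and T :: "'a \<Rightarrow> 'a"
  assumes "separated TYPE('a)"
    and "generates_uniformity F"
    and "complete (UNIV :: 'a set)"
    and "Id \<subseteq> E"
    and "banach_contraction F E T"
    and "orbitally_continuous T"
  shows "(\<forall>x. T x \<in> component E x \<longrightarrow>
            (\<exists>!z. z \<in> Fix T \<and> (\<forall>y \<in> component E x. (\<lambda>n. (T ^^ n) y) \<longlonglongrightarrow> z)) \<and>
            (\<forall>z. z \<in> Fix T \<and> (\<forall>y \<in> component E x. (\<lambda>n. (T ^^ n) y) \<longlonglongrightarrow> z) \<and>
                 z \<in> component E x \<longrightarrow> picard_on (component E x) T))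
       \<and> (weakly_connected E \<longrightarrow> picard_on UNIV T)
       \<and> ((\<exists>x. x \<in> Fix T) \<longleftrightarrow> (\<exists>x. T x \<in> component E x))
       \<and> weakly_picard_on (\<Union>{component E x | x. T x \<in> component E x}) T
       \<and> ((\<forall>x. T x \<in> component E x) \<longrightarrow> weakly_picard_on UNIV T)"
proof -
  note sep = assms(1) and F = assms(2)
  note orbits = component_orbits_converge_to_fixed_point[OF assms(1-3,5,6)]
  have pres: "\<And>x y. (x, y) \<in> E \<Longrightarrow> (T x, T y) \<in> E"
    using assms(5) by (simp add: banach_contraction_def)
  have unique: "z = w"
    if "(\<lambda>n. (T ^^ n) y) \<longlonglongrightarrow> z" "(\<lambda>n. (T ^^ n) y) \<longlonglongrightarrow> w" for y z w
    using separated_tendsto_unique[OF sep F sequentially_bot that] .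
  have const: "(\<lambda>n. (T ^^ n) w) \<longlonglongrightarrow> w" if "w \<in> Fix T" for w
  proof -
    have "(T ^^ n) w = w" for n
      using that by (induction n) (auto simp: Fix_def)
    then show ?thesis by simp
  qed
  have picard: "picard_on (component E x) T"
    if "T x \<in> component E x" "z \<in> Fix T" "z \<in> component E x"
      and "\<And>y. y \<in> component E x \<Longrightarrow> (\<lambda>n. (T ^^ n) y) \<longlonglongrightarrow> z" for x z
    unfolding picard_on_def
  proof (intro conjI exI[of _ z] ballI)
    show "T ` component E x \<subseteq> component E x"
      using component_image_subset[where T = T, OF pres that(1)] .
    \<comment> \<open>The orbit of a fixed point \<open>w\<close> is constant, so it tends to
      \<open>w\<close>; lying in the component, it also tends to \<open>z\<close>.\<close>
    show "w = z" if "w \<in> component E x \<inter> Fix T" for w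
      using that const[of w] \<open>\<And>y. y \<in> component E x \<Longrightarrow> (\<lambda>n. (T ^^ n) y) \<longlonglongrightarrow> z\<close>[of w]
      by (intro unique[of w]) auto
  qed (use that in auto)
  have weakly: "weakly_picard_on (\<Union>{component E x | x. T x \<in> component E x}) T"
    unfolding weakly_picard_on_def
  proof (intro conjI ballI)
    show "T ` \<Union>{component E x | x. T x \<in> component E x}
        \<subseteq> \<Union>{component E x | x. T x \<in> component E x}"
      using component_image_subset[where T = T, OF pres] by blast
  next
    fix y assume "y \<in> \<Union>{component E x | x. T x \<in> component E x}"
    then obtain x where x: "T x \<in> component E x" "y \<in> component E x" by blast
    then show "\<exists>z\<in>Fix T. (\<lambda>n. (T ^^ n) y) \<longlonglongrightarrow> z"
      using orbits[OF x(1)] by blast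
  qed
  show ?thesis
  proof (intro conjI allI impI)
    fix x assume x: "T x \<in> component E x"
    obtain z where z: "z \<in> Fix T" "\<And>y. y \<in> component E x \<Longrightarrow> (\<lambda>n. (T ^^ n) y) \<longlonglongrightarrow> z"
      using orbits[OF x] by blast
    \<comment> \<open>Uniqueness is read off from the orbit of \<open>x\<close> itself, a member of
      its own component.\<close>
    then show "\<exists>!z. z \<in> Fix T \<and> (\<forall>y \<in> component E x. (\<lambda>n. (T ^^ n) y) \<longlonglongrightarrow> z)"
      using unique component_refl[of x E] by blast
  next
    fix x z
    assume "T x \<in> component E x"
      and "z \<in> Fix T \<and> (\<forall>y \<in> component E x. (\<lambda>n. (T ^^ n) y) \<longlonglongrightarrow> z) \<and> z \<in> component E x"
    then show "picard_on (component E x) T"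
      using picard[of x z] by blast
  next
    assume "weakly_connected E"
    then have comp: "component E x = UNIV" for x
      by (simp add: weakly_connected_def)
    fix x
    obtain z where "z \<in> Fix T" "\<And>y. y \<in> component E x \<Longrightarrow> (\<lambda>n. (T ^^ n) y) \<longlonglongrightarrow> z"
      using orbits[of x] by (auto simp: comp)
    then have "picard_on (component E x) T"
      using picard[of x z] by (simp add: comp)
    then show "picard_on UNIV T" by (simp add: comp)
  next
    show "(\<exists>x. x \<in> Fix T) \<longleftrightarrow> (\<exists>x. T x \<in> component E x)"
    proof
      assume "\<exists>x. x \<in> Fix T"
      then obtain x where "T x = x" by (auto simp: Fix_def)
      \<comment> \<open>For a fixed point, the path of length zero joins \<open>x\<close> to
        \<open>T x\<close>.\<close>
      with component_refl[of x E] have "T x \<in> component E x" by simp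
      then show "\<exists>x. T x \<in> component E x" ..
    next
      assume "\<exists>x. T x \<in> component E x"
      then obtain x where "T x \<in> component E x" ..
      then show "\<exists>x. x \<in> Fix T"
        using orbits[of x] by blast
    qed
  next
    assume "\<forall>x. T x \<in> component E x"
    \<comment> \<open>Every point is covered by its own component, so the last claim is the case of
      the previous one where the union is everything.\<close>
    then have "\<Union>{component E x | x. T x \<in> component E x} = UNIV"
      using component_refl[of _ E] by auto
    with weakly show "weakly_picard_on UNIV T" by simp
  qed (rule weakly)
qed

end
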